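(* Let $\rho$ be a positive integer. For $n\ge1$ define $$q_n^{(\rho)}=\sum_{k=0}^{n}b_{k,n}^{(\rho)},\qquad p_n^{(\rho)}=\sum_{k=1}^{n}\Big(b_{k,n}^{(\rho)}H_k^{(3)}+\tfrac12 a_{k,n}^{(\rho)}H_k^{(2)}\Big),\qquad r_n^{(\rho)}=-\tfrac12\sum_{j\ge0}\mathcal{F}_{n,2}^{(\rho)}(j).$$ Then each of the three sequences $y_n=q_n^{(\rho)}$, $y_n=p_n^{(\rho)}$, $y_n=r_n^{(\rho)}$ satisfies, for all $n\ge1$, $$(n+2)^4\Phi_n^{(\rho)}y_{n+2}+\beta_n^{(\rho)}y_{n+1}+n^4\Phi_{n+1}^{(\rho)}y_n=0,$$ where $$\Phi_n^{(\rho)}=24n^5\rho^2-12n^5+54n^4\rho^2+39n^4\rho-33n^4+46n^3\rho^2+70n^3\rho+19n^2\rho^2+56n^2\rho+33n^2+3n\rho^2+21n\rho+24n+3\rho+5$$ and $$\begin{aligned}\beta_n^{(\rho)}=-2(n+1)\big(&408n^8\rho^2-204n^8+3162n^7\rho^2+663n^7\rho-1683n^7+10028n^6\rho^2+4433n^6\rho-4899n^6\\&+16802n^5\rho^2+12409n^5\rho-5487n^5+16070n^4\rho^2+18955n^4\rho+735n^4+8888n^3\rho^2\\&+17212n^3\rho+7366n^3+2708n^2\rho^2+9340n^2\rho+6870n^2+344n\rho^2+2776n\rho+2748n+344\rho+412\big).\end{aligned}$$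
   Context: $(z)_k=\prod_{j=0}^{k-1}(z+j)$, $(z)_0=1$. $H_k^{(r)}=\sum_{j=1}^k j^{-r}$, $H_k=H_k^{(1)}$, $H_0=0$. $\mathcal{F}_{n,1}^{(\rho)}(z)=\dfrac{(-z)_{n-1}^2(z-n+1)(z-\rho n)}{(z+1)_{n+1}^2}$ and $\mathcal{F}_{n,2}^{(\rho)}=\frac{d}{dz}\mathcal{F}_{n,1}^{(\rho)}$. For $k=0,\dots,n$: $b_{k,n}^{(\rho)}=\binom{n+k}{k}^2\binom{n}{k}^2\frac{k+\rho n+1}{n+k}$ and $a_{k,n}^{(\rho)}=2b_{k,n}^{(\rho)}\big[2H_k-H_{n+k-1}-H_{n-k}-\frac{(\rho+1)n+2k+1}{2(k+\rho n+1)(n+k)}\big]$. *)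

theory Defs
  imports "HOL-Analysis.Analysis"
begin

definition gen_harm :: "nat \<Rightarrow> nat \<Rightarrow> real" where
  "gen_harm r k = (\<Sum>j=1..k. 1 / real j ^ r)"

lemma gen_harm_1: "gen_harm 1 k = harm k"
  by (simp add: gen_harm_def harm_def divide_inverse)

text \<open>
  All notions below are used for \<open>n \<ge> 1\<close> and \<open>k \<le> n\<close> only, so the natural number subtractions
  \<open>n - 1\<close>, \<open>n + k - 1\<close> and \<open>n - k\<close> do not truncate.
\<close>

definition F1 :: "nat \<Rightarrow> nat \<Rightarrow> real \<Rightarrow> real" where
  "F1 \<rho> n z = (pochhammer (- z) (n - 1))\<^sup>2 * (z - real n + 1) * (z - real \<rho> * real n)
                / (pochhammer (z + 1) (n + 1))\<^sup>2"

definition F2 :: "nat \<Rightarrow> nat \<Rightarrow> real \<Rightarrow> real" where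
  "F2 \<rho> n = deriv (F1 \<rho> n)"

definition b_coeff :: "nat \<Rightarrow> nat \<Rightarrow> nat \<Rightarrow> real" where
  "b_coeff \<rho> n k = (real ((n + k) choose k))\<^sup>2 * (real (n choose k))\<^sup>2
                     * ((real k + real \<rho> * real n + 1) / (real n + real k))"

definition a_coeff :: "nat \<Rightarrow> nat \<Rightarrow> nat \<Rightarrow> real" where
  "a_coeff \<rho> n k = 2 * b_coeff \<rho> n k *
     (2 * harm k - harm (n + k - 1) - harm (n - k)
      - ((real \<rho> + 1) * real n + 2 * real k + 1)
          / (2 * (real k + real \<rho> * real n + 1) * (real n + real k)))"

definition q_seq :: "nat \<Rightarrow> nat \<Rightarrow> real" where
  "q_seq \<rho> n = (\<Sum>k=0..n. b_coeff \<rho> n k)"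

definition p_seq :: "nat \<Rightarrow> nat \<Rightarrow> real" where
  "p_seq \<rho> n = (\<Sum>k=1..n. b_coeff \<rho> n k * gen_harm 3 k + 1 / 2 * a_coeff \<rho> n k * gen_harm 2 k)"

definition r_seq :: "nat \<Rightarrow> nat \<Rightarrow> real" where
  "r_seq \<rho> n = - (1 / 2) * (\<Sum>j. F2 \<rho> n (real j))"

definition Phi :: "real \<Rightarrow> real \<Rightarrow> real" where
  "Phi \<rho> n = 24*n^5*\<rho>^2 - 12*n^5 + 54*n^4*\<rho>^2 + 39*n^4*\<rho> - 33*n^4 + 46*n^3*\<rho>^2 + 70*n^3*\<rho>
     + 19*n^2*\<rho>^2 + 56*n^2*\<rho> + 33*n^2 + 3*n*\<rho>^2 + 21*n*\<rho> + 24*n + 3*\<rho> + 5"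

definition beta :: "real \<Rightarrow> real \<Rightarrow> real" where
  "beta \<rho> n = - 2 * (n + 1) *
     (408*n^8*\<rho>^2 - 204*n^8 + 3162*n^7*\<rho>^2 + 663*n^7*\<rho> - 1683*n^7 + 10028*n^6*\<rho>^2 + 4433*n^6*\<rho>
      - 4899*n^6 + 16802*n^5*\<rho>^2 + 12409*n^5*\<rho> - 5487*n^5 + 16070*n^4*\<rho>^2 + 18955*n^4*\<rho>
      + 735*n^4 + 8888*n^3*\<rho>^2 + 17212*n^3*\<rho> + 7366*n^3 + 2708*n^2*\<rho>^2 + 9340*n^2*\<rho>
      + 6870*n^2 + 344*n*\<rho>^2 + 2776*n*\<rho> + 2748*n + 344*\<rho> + 412)"

end

theory Submission
  imports Defs "HOL-Computational_Algebra.Polynomial"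
begin

text \<open>
  Creative telescoping: the rational function \<open>G = telescoper \<rho> n\<close> of \<open>z\<close> is such that the recurrence operator
  applied to \<open>F1 \<rho> n z\<close> in \<open>n\<close> equals \<open>G (z + 1) - G z\<close>, up to the factor \<open>(n + 1)\<^sup>2\<close>.
  Differentiating in \<open>z\<close> and summing over \<open>z = 0, 1, \<dots>\<close> gives the recurrence for \<open>r\<close>,
  because \<open>G\<close> has a double zero at \<open>0\<close> and is bounded at infinity. Since \<open>b_coeff \<rho> n k\<close> is the
  leading Laurent coefficient of \<open>F1 \<rho> n\<close> at the double pole \<open>z = - k - 1\<close>, the same certificate read
  at these points telescopes the sum defining \<open>q\<close>. Finally \<open>a_coeff \<rho> n k\<close> is the residue at that pole,
  and the residues add up to \<open>0\<close>, so the partial fraction expansion of \<open>F1 \<rho> n\<close> yields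
  \<open>r = q \<zeta>(3) - p\<close>, and the recurrence for \<open>p\<close> follows by linearity.
\<close>

section \<open>The telescoping certificate\<close>

text \<open>
  The coefficients solve the linear system of Gosper's equation, a polynomial ansatz of degree 4
  in \<open>z\<close> for the certificate; one linear factor \<open>z - n\<close> is split off in \<open>shifted_cert\<close>
  below, and a denominator \<open>(n + 1)\<^sup>2\<close> has been cleared.
\<close>

definition cert0 :: "real \<Rightarrow> real \<Rightarrow> real" where
  "cert0 \<rho> n =
    -384*n^7 - 2400*n^6 - 5940*n^5 - 7614*n^4 - 5646*n^3 - 2546*n^2 - 638*n - 68
     + 384*n^12*\<rho> + 4704*n^11*\<rho> + 24072*n^10*\<rho> + 66576*n^9*\<rho>
     + 103560*n^8*\<rho> + 71900*n^7*\<rho> - 40804*n^6*\<rho> - 147376*n^5*\<rho>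
     - 161574*n^4*\<rho> - 100978*n^3*\<rho> - 38206*n^2*\<rho> - 8158*n*\<rho>
     - 756*\<rho> - 1248*n^11*\<rho>^2 - 13328*n^10*\<rho>^2 - 63972*n^9*\<rho>^2
     - 182558*n^8*\<rho>^2 - 344618*n^7*\<rho>^2 - 452316*n^6*\<rho>^2
     - 421776*n^5*\<rho>^2 - 279834*n^4*\<rho>^2 - 129414*n^3*\<rho>^2
     - 39576*n^2*\<rho>^2 - 7180*n*\<rho>^2 - 584*\<rho>^2 - 768*n^12*\<rho>^3
     - 9024*n^11*\<rho>^3 - 47096*n^10*\<rho>^3 - 144160*n^9*\<rho>^3
     - 287782*n^8*\<rho>^3 - 394002*n^7*\<rho>^3 - 378616*n^6*\<rho>^3
     - 256568*n^5*\<rho>^3 - 120806*n^4*\<rho>^3 - 37738*n^3*\<rho>^3 - 7008*n^2*\<rho>^3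
     - 584*n*\<rho>^3"

definition cert1 :: "real \<Rightarrow> real \<Rightarrow> real" where
  "cert1 \<rho> n =
    -384*n^11 - 4320*n^10 - 19668*n^9 - 46074*n^8 - 55236*n^7 - 17606*n^6 + 43068*n^5
     + 71960*n^4 + 54954*n^3 + 23786*n^2 + 5642*n + 570 + 960*n^10*\<rho>
     + 9320*n^9*\<rho> + 40636*n^8*\<rho> + 105230*n^7*\<rho> + 181052*n^6*\<rho>
     + 217462*n^5*\<rho> + 183328*n^4*\<rho> + 105398*n^3*\<rho> + 39094*n^2*\<rho>
     + 8438*n*\<rho> + 802*\<rho> + 768*n^11*\<rho>^2 + 8256*n^10*\<rho>^2
     + 39452*n^9*\<rho>^2 + 110238*n^8*\<rho>^2 + 201088*n^7*\<rho>^2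
     + 253912*n^6*\<rho>^2 + 228342*n^5*\<rho>^2 + 146372*n^4*\<rho>^2
     + 65358*n^3*\<rho>^2 + 19442*n^2*\<rho>^2 + 3452*n*\<rho>^2 + 276*\<rho>^2
     + 576*n^10*\<rho>^3 + 5280*n^9*\<rho>^3 + 21172*n^8*\<rho>^3 + 48550*n^7*\<rho>^3
     + 69570*n^6*\<rho>^3 + 63944*n^5*\<rho>^3 + 37504*n^4*\<rho>^3 + 13698*n^3*\<rho>^3
     + 2926*n^2*\<rho>^3 + 276*n*\<rho>^3"

definition cert2 :: "real \<Rightarrow> real \<Rightarrow> real" where
  "cert2 \<rho> n =
    384*n^9 + 3336*n^8 + 10344*n^7 + 12762*n^6 - 90*n^5 - 16848*n^4 - 19104*n^3
     - 10306*n^2 - 2854*n - 324 - 192*n^10*\<rho> - 1872*n^9*\<rho> - 8664*n^8*\<rho>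
     - 24132*n^7*\<rho> - 41740*n^6*\<rho> - 44014*n^5*\<rho> - 27254*n^4*\<rho>
     - 9136*n^3*\<rho> - 1154*n^2*\<rho> + 178*n*\<rho> + 52*\<rho> - 144*n^9*\<rho>^2
     - 1160*n^8*\<rho>^2 - 1960*n^7*\<rho>^2 + 4196*n^6*\<rho>^2 + 19082*n^5*\<rho>^2
     + 28420*n^4*\<rho>^2 + 22334*n^3*\<rho>^2 + 10144*n^2*\<rho>^2 + 2516*n*\<rho>^2
     + 264*\<rho>^2 + 384*n^10*\<rho>^3 + 3552*n^9*\<rho>^3 + 14632*n^8*\<rho>^3
     + 35032*n^7*\<rho>^3 + 52986*n^6*\<rho>^3 + 51638*n^5*\<rho>^3 + 32074*n^4*\<rho>^3
     + 12318*n^3*\<rho>^3 + 2728*n^2*\<rho>^3 + 264*n*\<rho>^3"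

definition cert3 :: "real \<Rightarrow> real \<Rightarrow> real" where
  "cert3 \<rho> n =
    192*n^9 + 1680*n^8 + 5340*n^7 + 7086*n^6 + 1182*n^5 - 7580*n^4 - 9544*n^3
     - 5396*n^2 - 1538*n - 178 - 720*n^8*\<rho> - 5176*n^7*\<rho> - 15256*n^6*\<rho>
     - 24238*n^5*\<rho> - 23038*n^4*\<rho> - 13712*n^3*\<rho> - 5076*n^2*\<rho>
     - 1070*n*\<rho> - 98*\<rho> - 384*n^9*\<rho>^2 - 3168*n^8*\<rho>^2
     - 10516*n^7*\<rho>^2 - 18214*n^6*\<rho>^2 - 17726*n^5*\<rho>^2 - 9524*n^4*\<rho>^2
     - 2242*n^3*\<rho>^2 + 282*n^2*\<rho>^2 + 276*n*\<rho>^2 + 44*\<rho>^2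
     + 192*n^8*\<rho>^3 + 1296*n^7*\<rho>^3 + 3500*n^6*\<rho>^3 + 4878*n^5*\<rho>^3
     + 3798*n^4*\<rho>^3 + 1690*n^3*\<rho>^3 + 418*n^2*\<rho>^3 + 44*n*\<rho>^3"

definition cert :: "real \<Rightarrow> real \<Rightarrow> real \<Rightarrow> real" where
  "cert \<rho> n z = cert0 \<rho> n + cert1 \<rho> n * z + cert2 \<rho> n * z^2 + cert3 \<rho> n * z^3"

text \<open>Gosper's equation with the common hypergeometric factor and one factor
  \<open>z - n + 1\<close> divided out. What is left is a polynomial identity in \<open>n\<close>,
  \<open>\<rho>\<close> and \<open>z\<close>, so it stays valid at the poles of
  \<open>F1\<close>.\<close>

lemma cert_identity:
  "(n + 1)^2 * ((n+2)^4 * Phi \<rho> n * ((z - n + 1) * (z - n)^2 * (z - n - 1) * (z - \<rho> * (n+2)))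
     + beta \<rho> n * ((z - n + 1) * (z + n + 3)^2 * (z - n) * (z - \<rho> * (n+1)))
     + n^4 * Phi \<rho> (n+1) * ((z + n + 2)^2 * (z + n + 3)^2 * (z - \<rho> * n)))
   = (z+1)^4 * cert \<rho> n (z + 1) - (z - n + 1) * (z - n) * (z + n + 3)^2 * cert \<rho> n z"
  unfolding cert_def cert0_def cert1_def cert2_def cert3_def Phi_def beta_def
  by algebra

definition shifted_cert :: "real \<Rightarrow> real \<Rightarrow> real \<Rightarrow> real" where
  "shifted_cert \<rho> n z = (z - n) * cert \<rho> n z"

text \<open>Multiplying by \<open>z - n + 1\<close> restores exactly what
  \<open>F1 \<rho> (n + 2) z\<close>, \<open>F1 \<rho> (n + 1) z\<close> and
  \<open>F1 \<rho> n z\<close> leave once their common factor is removed.\<close>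

lemma shifted_cert_identity:
  "(n + 1)^2 * ((n+2)^4 * Phi \<rho> n * ((n - 1 - z)^2 * (n - z)^2 * (z - n - 1) * (z - \<rho> * (n+2)))
     + beta \<rho> n * ((n - 1 - z)^2 * (z + n + 3)^2 * (z - n) * (z - \<rho> * (n+1)))
     + n^4 * Phi \<rho> (n+1) * ((z + n + 2)^2 * (z + n + 3)^2 * (z - n + 1) * (z - \<rho> * n)))
   = (z+1)^4 * shifted_cert \<rho> n (z + 1) - (n - 1 - z)^2 * (z + n + 3)^2 * shifted_cert \<rho> n z"
proof -
  \<comment> \<open>With the values of \<open>Phi\<close>, \<open>beta\<close> and
    \<open>cert\<close> kept as indeterminates, only the multiplication by \<open>z - n + 1\<close>
    remains to be checked.\<close>
  define f g h where "f = Phi \<rho> n" and "g = beta \<rho> n" and "h = Phi \<rho> (n + 1)"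
  define c d where "c = cert \<rho> n (z + 1)" and "d = cert \<rho> n z"
  have "(n + 1)^2 * ((n+2)^4 * f * ((z - n + 1) * (z - n)^2 * (z - n - 1) * (z - \<rho> * (n+2)))
     + g * ((z - n + 1) * (z + n + 3)^2 * (z - n) * (z - \<rho> * (n+1)))
     + n^4 * h * ((z + n + 2)^2 * (z + n + 3)^2 * (z - \<rho> * n)))
   = (z+1)^4 * c - (z - n + 1) * (z - n) * (z + n + 3)^2 * d"
    using cert_identity[of n \<rho> z] unfolding f_def g_def h_def c_def d_def .
  then have "(n + 1)^2 * ((n+2)^4 * f * ((n - 1 - z)^2 * (n - z)^2 * (z - n - 1) * (z - \<rho> * (n+2)))
     + g * ((n - 1 - z)^2 * (z + n + 3)^2 * (z - n) * (z - \<rho> * (n+1)))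
     + n^4 * h * ((z + n + 2)^2 * (z + n + 3)^2 * (z - n + 1) * (z - \<rho> * n)))
   = (z+1)^4 * ((z + 1 - n) * c) - (n - 1 - z)^2 * (z + n + 3)^2 * ((z - n) * d)"
    by algebra
  then show ?thesis
    unfolding shifted_cert_def f_def g_def h_def c_def d_def .
qed

section \<open>The recurrence for the denominators\<close>

text \<open>For \<open>n \<ge> 1\<close> this is the product of the two binomials in
  \<open>b_coeff\<close> divided by \<open>n + k\<close>. The quotient
  \<open>(n choose k) / fact n\<close> stands for 1 / (k! (n - k)!) and vanishes for
  \<open>k > n\<close>, so the relations under shifts of \<open>n\<close> hold for every
  \<open>k\<close>.\<close>

definition b_root :: "nat \<Rightarrow> nat \<Rightarrow> real" where
  "b_root n k = fact (n + k - 1) / fact k * (real (n choose k) / fact n)"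

lemma b_coeff_eq_b_root:
  assumes "n \<ge> 1"
  shows "b_coeff \<rho> n k = (b_root n k)\<^sup>2 * (real n + real k) * (real k + real \<rho> * real n + 1)"
proof -
  have "real ((n + k) choose k) = fact (n + k) / (fact k * fact n)"
    by (simp add: binomial_fact)
  moreover have "(fact (n + k) :: real) = (real n + real k) * fact (n + k - 1)"
    using assms by (subst fact_reduce) auto
  moreover have "real n + real k > 0" using assms by simp
  ultimately show ?thesis
    unfolding b_coeff_def b_root_def by (simp only:) (simp add: divide_simps power2_eq_square)
qed

text \<open>This is 1 / (n - k)! = (n + 1 - k) / (n + 1 - k)!. For \<open>k = n + 1\<close> both
  sides vanish through the linear factor and the left binomial; for larger \<open>k\<close> both
  binomials are 0.\<close>

lemma binomial_div_fact_Suc: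
  "real (n choose k) / fact n = (real n + 1 - real k) * (real (Suc n choose k) / fact (Suc n))"
proof -
  have "(real n + 1 - real k) * real (Suc n choose k) = (real n + 1) * real (n choose k)"
  proof (cases "k \<le> Suc n")
    case True
    have "real (Suc n - k) * real (Suc n choose k) = real (Suc n) * real (n choose k)"
      using binomial_absorb_comp[of "Suc n" k] by (metis diff_Suc_1 of_nat_mult)
    then show ?thesis using True by (simp add: of_nat_diff add.commute)
  qed (simp add: binomial_eq_0)
  then have "(real n + 1 - real k) * (real (Suc n choose k) / fact (Suc n))
      = (real n + 1) * real (n choose k) / fact (Suc n)"
    by (simp only: times_divide_eq_right)
  also have "\<dots> = real (n choose k) / fact n"
    by (simp add: add.commute)
  finally show ?thesis by simp
qed

text \<open>The polynomial identity at \<open>z = - k - 1\<close>, multiplied by the square of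
  \<open>t k\<close>, telescopes over \<open>k\<close>. The boundary terms vanish:
  \<open>h 0\<close> through the factor \<open>real k ^ 4\<close>, \<open>h (n + 3)\<close> through
  the binomial in \<open>t\<close>.\<close>

lemma q_recurrence:
  assumes n: "n \<ge> 1"
  shows "(real n + 2) ^ 4 * Phi (real \<rho>) (real n) * q_seq \<rho> (n + 2)
           + beta (real \<rho>) (real n) * q_seq \<rho> (n + 1)
           + real n ^ 4 * Phi (real \<rho>) (real n + 1) * q_seq \<rho> n = 0"
proof -
  \<comment> \<open>The common factor of \<open>b_root n k\<close>, \<open>b_root (n + 1) k\<close>
    and \<open>b_root (n + 2) k\<close>; the linear factors that remain are found in
    \<open>W0\<close>, \<open>W1\<close> and \<open>W2\<close>.\<close>
  define t where "t k = fact (n + k - 1) / fact k * (real ((n + 2) choose k) / fact (n + 2))" for k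
  define X where "X = shifted_cert (real \<rho>) (real n)"
  define h where "h k = (t k)\<^sup>2 * real k ^ 4 * X (- real k)" for k
  define c2 c1 c0 where "c2 = (real n + 2) ^ 4 * Phi (real \<rho>) (real n)"
    and "c1 = beta (real \<rho>) (real n)" and "c0 = real n ^ 4 * Phi (real \<rho>) (real n + 1)"
  have fact1: "(fact (n + k) :: real) = (real n + real k) * fact (n + k - 1)" for k
    using n by (subst fact_reduce) auto
  have W0: "b_root n k = t k * (real n + 2 - real k) * (real n + 1 - real k)" for k
  proof -
    have "real (n choose k) / fact n
        = (real n + 1 - real k) * ((real n + 2 - real k) * (real ((n + 2) choose k) / fact (n + 2)))"
      using binomial_div_fact_Suc[of n k] binomial_div_fact_Suc[of "Suc n" k]
      by (simp del: fact_Suc binomial_Suc_Suc add: add.commute)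
    then show ?thesis
      unfolding b_root_def t_def by (simp only: ac_simps)
  qed
  have W1: "b_root (n + 1) k = t k * (real n + 2 - real k) * (real n + real k)" for k
    using binomial_div_fact_Suc[of "Suc n" k] fact1[of k]
    by (simp add: b_root_def t_def)
  have W2: "b_root (n + 2) k = t k * (real n + real k + 1) * (real n + real k)" for k
    using fact1[of k] by (simp add: b_root_def t_def)
  \<comment> \<open>The ratio of \<open>t (Suc k)\<close> to \<open>t k\<close> is (n + k)(n + 2 -
    k) / (k + 1)^2. Its square turns the subtracted term of the identity at
    \<open>z = - k - 1\<close> into \<open>h (Suc k)\<close>.\<close>
  have t_Suc: "(t (Suc k))\<^sup>2 * real (Suc k) ^ 4 = (t k)\<^sup>2 * (real n + real k)\<^sup>2 * (real n + 2 - real k)\<^sup>2" for k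
  proof -
    have "real (Suc k) * real ((n + 2) choose Suc k) = (real n + 2 - real k) * real ((n + 2) choose k)"
    proof (cases "k \<le> n + 2")
      case True
      have "real (Suc k) * real ((n + 2) choose Suc k) = real (n + 2 - k) * real ((n + 2) choose k)"
        using binomial_absorption[of k "n + 2"] binomial_absorb_comp[of "n + 2" k]
        by (metis of_nat_mult)
      then show ?thesis using True by (simp add: of_nat_diff)
    qed (simp add: binomial_eq_0)
    moreover have "t (Suc k) * real (Suc k)^2
        = fact (n + k) / fact k * (real (Suc k) * real ((n + 2) choose Suc k) / fact (n + 2))"
      unfolding t_def fact_Suc[of k] power2_eq_square
      by (simp del: of_nat_Suc fact_Suc binomial_Suc_Suc add: divide_simps)
    ultimately have "t (Suc k) * real (Suc k)^2 = t k * (real n + real k) * (real n + 2 - real k)"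
      unfolding t_def fact1[of k]
      by (simp del: of_nat_Suc fact_Suc binomial_Suc_Suc)
    then have "(t (Suc k) * real (Suc k)^2)^2 = (t k * (real n + real k) * (real n + 2 - real k))^2"
      by simp
    then show ?thesis by (simp add: power_mult_distrib)
  qed
  have le1: "1 \<le> n + 1" and le2: "1 \<le> n + 2" by simp_all
  have step: "(real n + 1)\<^sup>2 * (c2 * b_coeff \<rho> (n + 2) k + c1 * b_coeff \<rho> (n + 1) k + c0 * b_coeff \<rho> n k)
      = h k - h (Suc k)" for k
  proof -
    define T where "T = (t k)\<^sup>2"
    define z where "z = - real k - 1"
    \<comment> \<open>Written in \<open>z\<close>, the two linear factors of \<open>b_coeff\<close>
      both change sign, so their product is unchanged.\<close>
    have B2: "b_coeff \<rho> (n + 2) k = T * ((real n - 1 - z)^2 * (real n - z)^2 * (z - real n - 1) * (z - \<rho> * (real n+2)))"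
      unfolding b_coeff_eq_b_root[OF le2] W2 of_nat_add of_nat_numeral of_nat_1 T_def z_def
      by algebra
    have B1: "b_coeff \<rho> (n + 1) k = T * ((real n - 1 - z)^2 * (z + real n + 3)^2 * (z - real n) * (z - \<rho> * (real n+1)))"
      unfolding b_coeff_eq_b_root[OF le1] W1 of_nat_add of_nat_numeral of_nat_1 T_def z_def
      by algebra
    have B0: "b_coeff \<rho> n k = T * ((z + real n + 2)^2 * (z + real n + 3)^2 * (z - real n + 1) * (z - \<rho> * real n))"
      unfolding b_coeff_eq_b_root[OF n] W0 of_nat_add of_nat_numeral of_nat_1 T_def z_def
      by algebra
    have "(real n + 1)\<^sup>2 * (c2 * b_coeff \<rho> (n + 2) k + c1 * b_coeff \<rho> (n + 1) k + c0 * b_coeff \<rho> n k)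
        = T * ((real n + 1)\<^sup>2 *
            (c2 * ((real n - 1 - z)^2 * (real n - z)^2 * (z - real n - 1) * (z - \<rho> * (real n+2)))
           + c1 * ((real n - 1 - z)^2 * (z + real n + 3)^2 * (z - real n) * (z - \<rho> * (real n+1)))
           + c0 * ((z + real n + 2)^2 * (z + real n + 3)^2 * (z - real n + 1) * (z - \<rho> * real n))))"
      unfolding B0 B1 B2 by algebra
    also have "\<dots> = T * ((z + 1)^4 * X (z + 1) - (real n - 1 - z)^2 * (z + real n + 3)^2 * X z)"
      unfolding c2_def c1_def c0_def X_def shifted_cert_identity by simp
    also have "\<dots> = T * (real k ^ 4 * X (- real k)) - T * (real n + real k)\<^sup>2 * (real n + 2 - real k)\<^sup>2 * X (- real (Suc k))"
    proof -
      have *: "z + 1 = - real k" "real n - 1 - z = real n + real k"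
        "z + real n + 3 = real n + 2 - real k" "X z = X (- real (Suc k))"
        by (auto simp: z_def intro: arg_cong[where f = X])
      show ?thesis unfolding * by (simp add: right_diff_distrib mult.assoc)
    qed
    also have "\<dots> = h k - h (Suc k)"
      unfolding h_def t_Suc T_def by simp
    finally show ?thesis .
  qed
  \<comment> \<open>Since \<open>b_coeff \<rho> m k\<close> is 0 for \<open>k > m\<close>, the three
    sums share one range.\<close>
  have q: "q_seq \<rho> m = (\<Sum>k<n + 3. b_coeff \<rho> m k)" if "m \<le> n + 2" for m
    unfolding q_seq_def using that
    by (intro sum.mono_neutral_left) (auto simp: b_coeff_def)
  have "(real n + 1)\<^sup>2 * (c2 * q_seq \<rho> (n + 2) + c1 * q_seq \<rho> (n + 1) + c0 * q_seq \<rho> n)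
      = (\<Sum>k<n + 3. (real n + 1)\<^sup>2 * (c2 * b_coeff \<rho> (n + 2) k + c1 * b_coeff \<rho> (n + 1) k + c0 * b_coeff \<rho> n k))"
    by (simp add: q sum.distrib sum_distrib_left algebra_simps)
  also have "\<dots> = h 0 - h (n + 3)"
    unfolding step by (rule sum_lessThan_telescope')
  also have "\<dots> = 0"
    by (simp add: h_def t_def)
  finally show ?thesis
    unfolding c2_def c1_def c0_def by (simp add: add_nonneg_eq_0_iff)
qed

section \<open>Hermite interpolation\<close>

lemma square_dvd_if_double_root:
  fixes p :: "'a::field poly"
  assumes "poly p s = 0" "poly (pderiv p) s = 0"
  shows "[:- s, 1:]\<^sup>2 dvd p"
proof -
  obtain q where q: "p = [:- s, 1:] * q"
    using assms(1) by (auto simp: poly_eq_0_iff_dvd dvd_def)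
  have "poly q s = 0"
    using assms(2) unfolding q pderiv_mult by (simp add: pderiv_pCons)
  then obtain r where "q = [:- s, 1:] * r"
    by (auto simp: poly_eq_0_iff_dvd dvd_def)
  then show ?thesis
    unfolding q power2_eq_square by (simp only: mult.assoc[symmetric] dvd_triv_left)
qed

text \<open>Roots are counted with multiplicity: each of the distinct nodes contributes at least 2,
  which together exceeds the degree.\<close>

lemma eq_0_if_many_double_roots:
  fixes p :: "'a::field poly"
  assumes fin: "finite I" and inj: "inj_on x I"
    and dvd: "\<And>i. i \<in> I \<Longrightarrow> [:- x i, 1:]\<^sup>2 dvd p"
    and deg: "degree p < 2 * card I"
  shows "p = 0"
proof (rule ccontr)
  assume p: "p \<noteq> 0"
  have ord: "order (x i) p \<ge> 2" if "i \<in> I" for i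
    using order_divides[of "x i" 2 p] dvd[OF that] p by simp
  have "2 * card I = (\<Sum>s\<in>x ` I. 2)"
    using inj by (simp add: card_image)
  also have "\<dots> \<le> (\<Sum>s\<in>x ` I. order s p)"
    by (intro sum_mono) (use ord in auto)
  also have "\<dots> \<le> (\<Sum>s | poly p s = 0. order s p)"
  proof (intro sum_mono2)
    show "finite {s. poly p s = 0}" using p by (rule poly_roots_finite)
    show "x ` I \<subseteq> {s. poly p s = 0}"
      using ord p by (force simp: order_root)
  qed auto
  also have "\<dots> \<le> degree p"
    using p by (rule sum_order_le_degree)
  finally show False using deg by simp
qed

lemma monic_prod_squares:
  fixes x :: "'i \<Rightarrow> 'a::field"
  assumes "finite J"
  shows "degree (\<Prod>j\<in>J. [:- x j, 1:]\<^sup>2) = 2 * card J"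
    and "lead_coeff (\<Prod>j\<in>J. [:- x j, 1:]\<^sup>2) = 1"
proof -
  show "degree (\<Prod>j\<in>J. [:- x j, 1:]\<^sup>2) = 2 * card J"
    by (subst degree_prod_eq_sum_degree) (auto simp: degree_power_eq)
  show "lead_coeff (\<Prod>j\<in>J. [:- x j, 1:]\<^sup>2) = 1"
    by (simp add: lead_coeff_prod lead_coeff_power)
qed

text \<open>\<open>b i\<close> and \<open>a i\<close> are the coefficients of the double and the
  simple pole at \<open>x i\<close> of \<open>p\<close> divided by the product of all
  \<open>(X - x j)^2\<close>; \<open>val\<close> and \<open>dval\<close> express this without
  division.\<close>

context
  fixes I :: "'i set" and x :: "'i \<Rightarrow> 'a::field" and a b :: "'i \<Rightarrow> 'a" and p :: "'a poly"
    and e :: "'i \<Rightarrow> 'a poly"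
  defines "e \<equiv> \<lambda>i. \<Prod>j\<in>I - {i}. [:- x j, 1:]\<^sup>2"
  assumes fin: "finite I" and inj: "inj_on x I"
    and val: "\<And>i. i \<in> I \<Longrightarrow> poly p (x i) = b i * poly (e i) (x i)"
    and dval: "\<And>i. i \<in> I \<Longrightarrow>
      poly (pderiv p) (x i) = a i * poly (e i) (x i) + b i * poly (pderiv (e i)) (x i)"
begin

text \<open>The linear factor is \<open>b i + a i * (X - x i)\<close>. Its term agrees with
  \<open>p\<close> to first order at \<open>x i\<close>, and every other \<open>e j\<close> is
  divisible by the square belonging to \<open>i\<close>. The difference thus has a double root at
  each node, but too small a degree.\<close>

lemma hermite_interpolation:
  assumes deg: "degree p < 2 * card I"
  shows "p = (\<Sum>i\<in>I. [:b i - a i * x i, a i:] * e i)"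
proof -
  define l where "l i = [:b i - a i * x i, a i:]" for i
  have "p - (\<Sum>i\<in>I. l i * e i) = 0"
  proof (rule eq_0_if_many_double_roots[OF fin inj])
    fix i assume i: "i \<in> I"
    have "[:- x i, 1:]\<^sup>2 dvd p - l i * e i"
    proof (rule square_dvd_if_double_root)
      show "poly (p - l i * e i) (x i) = 0"
        using val[OF i] by (simp add: l_def algebra_simps)
      show "poly (pderiv (p - l i * e i)) (x i) = 0"
        using dval[OF i] unfolding pderiv_diff pderiv_mult l_def
        by (simp add: pderiv_pCons algebra_simps)
    qed
    moreover have "[:- x i, 1:]\<^sup>2 dvd (\<Sum>j\<in>I - {i}. l j * e j)"
      using i fin by (intro dvd_sum dvd_mult) (auto simp: e_def intro!: dvd_prodI)
    moreover have "p - (\<Sum>i\<in>I. l i * e i) = (p - l i * e i) - (\<Sum>j\<in>I - {i}. l j * e j)"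
      using i fin by (simp add: sum.remove)
    ultimately show "[:- x i, 1:]\<^sup>2 dvd p - (\<Sum>i\<in>I. l i * e i)"
      by (metis dvd_diff)
  next
    have "degree (l i * e i) < 2 * card I" if "i \<in> I" for i
    proof -
      have "card I > 0" using fin that by (auto simp: card_gt_0_iff)
      moreover have "degree (e i) = 2 * (card I - 1)"
        unfolding e_def using fin that by (subst monic_prod_squares) auto
      moreover have "degree (l i) \<le> 1" by (simp add: l_def)
      ultimately show ?thesis using degree_mult_le[of "l i" "e i"] by linarith
    qed
    moreover have "card I > 0" using deg by simp
    ultimately have "degree (\<Sum>i\<in>I. l i * e i) < 2 * card I"
      by (intro degree_sum_less) auto
    then show "degree (p - (\<Sum>i\<in>I. l i * e i)) < 2 * card I"
      using deg by (rule degree_diff_less[rotated])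
  qed
  then show ?thesis by (simp add: l_def)
qed

text \<open>Coefficients of degree \<open>2 * card I - 1\<close> are compared: each
  \<open>e i\<close> is monic of degree \<open>2 * card I - 2\<close>, so its term contributes
  \<open>a i\<close>, and \<open>p\<close> contributes nothing. Analytically, there is no residue at
  infinity.\<close>

lemma sum_residues_eq_0:
  assumes deg: "degree p + 1 < 2 * card I"
  shows "(\<Sum>i\<in>I. a i) = 0"
proof -
  have c: "coeff ([:b i - a i * x i, a i:] * e i) (2 * card I - 1) = a i" if "i \<in> I" for i
  proof -
    have "card I > 0" using fin that by (auto simp: card_gt_0_iff)
    then have *: "2 * card I - 1 = Suc (2 * (card I - 1))" by simp
    have d: "degree (e i) = 2 * (card I - 1)" "lead_coeff (e i) = 1"
      unfolding e_def using fin that monic_prod_squares[of "I - {i}" x] by auto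
    then have "coeff (e i) (Suc (2 * (card I - 1))) = 0" by (intro coeff_eq_0) simp
    then show ?thesis unfolding * using d by simp
  qed
  have "(\<Sum>i\<in>I. a i) = coeff (\<Sum>i\<in>I. [:b i - a i * x i, a i:] * e i) (2 * card I - 1)"
    unfolding coeff_sum using c by (intro sum.cong) auto
  also have "\<dots> = coeff p (2 * card I - 1)"
    using hermite_interpolation deg by simp
  also have "\<dots> = 0" using deg by (intro coeff_eq_0) simp
  finally show ?thesis .
qed

end

section \<open>Logarithmic derivatives; products and sums over punctured ranges\<close>

lemma poly_pderiv_prod_squares:
  fixes f :: "'i \<Rightarrow> 'a::field poly"
  assumes "finite J" "\<And>j. j \<in> J \<Longrightarrow> poly (f j) s \<noteq> 0"
  shows "poly (pderiv (\<Prod>j\<in>J. (f j)\<^sup>2)) s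
    = poly (\<Prod>j\<in>J. (f j)\<^sup>2) s * (2 * (\<Sum>j\<in>J. poly (pderiv (f j)) s / poly (f j) s))"
  using assms
proof (induction J rule: finite_induct)
  case empty
  then show ?case by simp
next
  case (insert i J)
  \<comment> \<open>Squaring doubles the logarithmic derivative of a factor; the product rule then
    adds up the factors.\<close>
  have "poly (pderiv ((f i)\<^sup>2)) s = poly ((f i)\<^sup>2) s * (2 * (poly (pderiv (f i)) s / poly (f i) s))"
    using insert.prems[of i] by (simp add: power2_eq_square pderiv_mult field_simps)
  then show ?case
    using insert by (simp add: pderiv_mult algebra_simps)
qed

text \<open>Both pieces are indexed by the distance to \<open>m\<close>, less one. An arbitrary
  commutative monoid covers products and sums alike.\<close>

lemma (in comm_monoid_set) remove_atMost_nat: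
  assumes "m \<le> n"
  shows "F g ({..n} - {m}) = f (F (\<lambda>i. g (m - Suc i)) {..<m}) (F (\<lambda>i. g (Suc m + i)) {..<n - m})"
proof -
  have "{..n} - {m} = {..<m} \<union> {Suc m..<Suc n}" using assms by auto
  moreover have "{..<m} \<inter> {Suc m..<Suc n} = {}" by auto
  ultimately have "F g ({..n} - {m}) = f (F g {..<m}) (F g {Suc m..<Suc n})"
    by (metis union_disjoint finite_lessThan finite_atLeastLessThan)
  moreover have "F g {..<m} = F (\<lambda>i. g (m - Suc i)) {..<m}"
    by (rule nat_diff_reindex[symmetric])
  moreover have "F g {Suc m..<Suc n} = F (\<lambda>i. g (Suc m + i)) {..<n - m}"
    using atLeastLessThan_shift_0[of g "Suc m" "Suc n"]
    by (simp only: atLeast0LessThan comp_def diff_Suc_Suc)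
  ultimately show ?thesis by simp
qed

lemma harm_eq_sum_lessThan: "harm n = (\<Sum>i<n. 1 / (real i + 1))"
  by (induction n) (auto simp: harm_Suc harm_expand(1) divide_inverse add.commute)

lemma harm_diff: "harm (m + n) - harm m = (\<Sum>i<n. 1 / (real m + real i + 1))"
  by (induction n) (auto simp: harm_Suc divide_inverse ac_simps)

lemma fact_eq_prod_lessThan: "fact n = (\<Prod>i<n. real i + 1)"
  by (induction n) (auto simp: ac_simps)

lemma fact_quotient: "fact (m + n) / fact m = (\<Prod>i<n. real m + real i + 1)"
proof (induction n)
  case (Suc n)
  have "fact (m + Suc n) / fact m = fact (m + n) / fact m * (real m + real n + 1)"
    by (simp add: algebra_simps)
  then show ?case using Suc by simp
qed simp

text \<open>The distances to \<open>m\<close> run from 1 to \<open>m\<close> below it and from 1 to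
  \<open>n - m\<close> above it; squaring removes the signs.\<close>

lemma prod_remove_diff:
  assumes "m \<le> n"
  shows "(\<Prod>j\<in>{..n} - {m}. (real j - real m)\<^sup>2) = (fact m * fact (n - m))\<^sup>2"
proof -
  have "(\<Prod>i<m. (real (m - Suc i) - real m)\<^sup>2) = (\<Prod>i<m. (real i + 1)\<^sup>2)"
    by (intro prod.cong) (auto simp: of_nat_diff power2_eq_square algebra_simps)
  then show ?thesis
    unfolding prod.remove_atMost_nat[OF assms]
    by (simp add: fact_eq_prod_lessThan power_mult_distrib prod_power_distrib add.commute)
qed

lemma sum_remove_diff:
  assumes "m \<le> n"
  shows "(\<Sum>j\<in>{..n} - {m}. 1 / (real j - real m)) = harm (n - m) - harm m"
proof -
  have "(\<Sum>i<m. 1 / (real (m - Suc i) - real m)) = (\<Sum>i<m. - (1 / (real i + 1)))"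
    by (intro sum.cong) (auto simp: of_nat_diff divide_simps)
  then show ?thesis
    unfolding sum.remove_atMost_nat[OF assms]
    by (simp add: harm_eq_sum_lessThan sum_negf add.commute)
qed

section \<open>Partial fractions\<close>

definition F1_numerator :: "nat \<Rightarrow> nat \<Rightarrow> real poly" where
  "F1_numerator \<rho> n =
     (\<Prod>i<n - 1. [:real i, - 1:]\<^sup>2) * ([:1 - real n, 1:] * [:- (real \<rho> * real n), 1:])"

lemma pochhammer_square_eq_prod: "(pochhammer z n)\<^sup>2 = (\<Prod>i<n. (z + real i)\<^sup>2)"
  by (simp add: pochhammer_prod prod_power_distrib atLeast0LessThan)

lemma F1_eq_poly:
  "F1 \<rho> n z = poly (F1_numerator \<rho> n) z / (\<Prod>k\<le>n. (z + real k + 1)\<^sup>2)"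
  by (simp add: F1_def F1_numerator_def pochhammer_square_eq_prod poly_prod lessThan_Suc_atMost
      algebra_simps)

text \<open>The denominator of \<open>F1\<close> has degree \<open>2 * n + 2\<close>; this gap of
  two makes the residues add up to 0 in \<open>sum_a_coeff\<close>.\<close>

lemma degree_F1_numerator:
  assumes "n \<ge> 1"
  shows "degree (F1_numerator \<rho> n) \<le> 2 * n"
proof -
  have "degree (\<Prod>i<n - 1. [:real i, - 1:]\<^sup>2) \<le> 2 * (n - 1)"
    by (subst degree_prod_eq_sum_degree) (auto simp: degree_power_eq)
  moreover have "degree ([:1 - real n, 1:] * [:- (real \<rho> * real n), 1:]) \<le> 2"
    by (rule order.trans[OF degree_mult_le]) simp
  ultimately show ?thesis
    unfolding F1_numerator_def using assms by (intro order.trans[OF degree_mult_le]) linarith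
qed

text \<open>\<open>b_coeff\<close> is the quotient of the numerator by \<open>e\<close> at the pole,
  and \<open>a_coeff\<close> is this quotient times the difference of their logarithmic derivatives.
  The harmonic numbers come from \<open>P\<close> and \<open>e\<close>, the rational term from
  \<open>Q\<close>.\<close>

lemma F1_hermite_data:
  fixes n k \<rho> :: nat
  defines "e \<equiv> \<Prod>j\<in>{..n} - {k}. [:- (- real j - 1), 1:]\<^sup>2"
  assumes n: "n \<ge> 1" and k: "k \<le> n"
  shows "poly (F1_numerator \<rho> n) (- real k - 1) = b_coeff \<rho> n k * poly e (- real k - 1)"
    and "poly (pderiv (F1_numerator \<rho> n)) (- real k - 1)
      = a_coeff \<rho> n k * poly e (- real k - 1) + b_coeff \<rho> n k * poly (pderiv e) (- real k - 1)"
proof -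
  define z where "z = - real k - 1"
  define P where "P = (\<Prod>i<n - 1. [:real i, - 1:]\<^sup>2)"
  define Q where "Q = [:1 - real n, 1:] * [:- (real \<rho> * real n), 1:]"
  have N: "F1_numerator \<rho> n = P * Q"
    by (simp only: F1_numerator_def P_def Q_def)
  \<comment> \<open>Up to sign, the linear factors of \<open>Q\<close> at \<open>z\<close>; the
    fraction in \<open>a_coeff\<close> is half of \<open>1 / u + 1 / v\<close>.\<close>
  define u v where "u = real n + real k" and "v = real k + real \<rho> * real n + 1"
  have uv: "u > 0" "v > 0" using n by (auto simp: u_def v_def add_nonneg_pos)
  have e_val: "poly e z = (fact k * fact (n - k))\<^sup>2"
    unfolding prod_remove_diff[OF k, symmetric] by (simp add: e_def z_def poly_prod)
  have "poly (pderiv e) z = poly e z * (2 * (\<Sum>j\<in>{..n} - {k}. 1 / (real j - real k)))"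
    unfolding e_def by (subst poly_pderiv_prod_squares) (auto simp: z_def pderiv_pCons)
  then have e_der: "poly (pderiv e) z = poly e z * (2 * (harm (n - k) - harm k))"
    unfolding sum_remove_diff[OF k] .
  \<comment> \<open>At \<open>z\<close> the polynomial \<open>P\<close> is the squared product of
    \<open>k + 1\<close> up to \<open>k + (n - 1)\<close>.\<close>
  have nk: "k + (n - 1) = n + k - 1" using n by simp
  have "poly P z = (\<Prod>i<n - 1. real k + real i + 1)\<^sup>2"
    by (simp add: P_def z_def poly_prod prod_power_distrib algebra_simps)
  then have P_val: "poly P z = (fact (n + k - 1) / fact k)\<^sup>2"
    unfolding fact_quotient[symmetric] nk .
  have "poly (pderiv P) z = poly P z * (2 * (\<Sum>i<n - 1. - (1 / (real k + real i + 1))))"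
    unfolding P_def
    by (subst poly_pderiv_prod_squares)
      (auto simp: z_def pderiv_pCons algebra_simps intro!: sum.cong)
  then have P_der: "poly (pderiv P) z = poly P z * (2 * (harm k - harm (n + k - 1)))"
    unfolding sum_negf harm_diff[symmetric] nk by simp
  have Q_val: "poly Q z = u * v" 
    by (simp add: Q_def z_def u_def v_def algebra_simps)
  have Q_der: "poly (pderiv Q) z = - (u + v)"
    by (simp add: Q_def z_def u_def v_def pderiv_mult pderiv_pCons algebra_simps)
  have b: "b_coeff \<rho> n k * poly e z = poly P z * (u * v)"
  proof -
    have "b_root n k = fact (n + k - 1) / ((fact k)\<^sup>2 * fact (n - k))"
      using k by (simp add: b_root_def binomial_fact power2_eq_square)
    then show ?thesis
      unfolding b_coeff_eq_b_root[OF n] e_val P_val u_def v_def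
      by (simp add: power2_eq_square)
  qed
  then show "poly (F1_numerator \<rho> n) z = b_coeff \<rho> n k * poly e z"
    by (simp add: N Q_val)
  have a: "a_coeff \<rho> n k = b_coeff \<rho> n k *
      (2 * (2 * harm k - harm (n + k - 1) - harm (n - k)) - (u + v) / (u * v))"
  proof -
    have "(real \<rho> + 1) * real n + 2 * real k + 1 = u + v"
      by (simp add: u_def v_def algebra_simps)
    moreover have "2 * (real k + real \<rho> * real n + 1) * (real n + real k) = 2 * (u * v)"
      by (simp add: u_def v_def)
    ultimately show ?thesis
      unfolding a_coeff_def by (simp only:) (simp add: right_diff_distrib)
  qed
  have "poly (pderiv (F1_numerator \<rho> n)) z
      = poly P z * (u * v) * (2 * (harm k - harm (n + k - 1)) - (u + v) / (u * v))"
  proof -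
    define w where "w = (u + v) / (u * v)"
    have "u * v * w = u + v" using uv by (simp add: w_def)
    then show ?thesis
      unfolding w_def[symmetric] N pderiv_mult poly_add poly_mult Q_val P_der Q_der by algebra
  qed
  also have "\<dots> = b_coeff \<rho> n k * poly e z * (2 * (harm k - harm (n + k - 1)) - (u + v) / (u * v))"
    unfolding b ..
  also have "\<dots> = a_coeff \<rho> n k * poly e z + b_coeff \<rho> n k * poly (pderiv e) z"
    unfolding a e_der by algebra
  finally show "poly (pderiv (F1_numerator \<rho> n)) z
      = a_coeff \<rho> n k * poly e z + b_coeff \<rho> n k * poly (pderiv e) z" .
qed

lemma sum_a_coeff:
  assumes n: "n \<ge> 1"
  shows "(\<Sum>k\<le>n. a_coeff \<rho> n k) = 0"
  by (rule sum_residues_eq_0[where x = "\<lambda>k. - real k - 1" and b = "b_coeff \<rho> n"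
        and p = "F1_numerator \<rho> n"])
    (use F1_hermite_data[OF n] degree_F1_numerator[OF n, of \<rho>] in \<open>auto simp: inj_on_def\<close>)

lemma F1_partial_fractions:
  assumes n: "n \<ge> 1" and z: "z > - 1"
  shows "F1 \<rho> n z
    = (\<Sum>k\<le>n. b_coeff \<rho> n k / (z + real k + 1)\<^sup>2 + a_coeff \<rho> n k / (z + real k + 1))"
proof -
  define e where "e k = (\<Prod>j\<in>{..n} - {k}. [:- (- real j - 1), 1:]\<^sup>2)" for k
  define w where "w k = z + real k + 1" for k
  have w: "w k \<noteq> 0" for k using z by (simp add: w_def)
  have "F1_numerator \<rho> n
      = (\<Sum>k\<le>n. [:b_coeff \<rho> n k - a_coeff \<rho> n k * (- real k - 1), a_coeff \<rho> n k:] * e k)"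
    unfolding e_def
    by (rule hermite_interpolation)
      (use F1_hermite_data[OF n] degree_F1_numerator[OF n, of \<rho>] in \<open>auto simp: inj_on_def\<close>)
  then have "poly (F1_numerator \<rho> n) z
      = (\<Sum>k\<le>n. (b_coeff \<rho> n k + a_coeff \<rho> n k * w k) * (\<Prod>j\<in>{..n} - {k}. (w j)\<^sup>2))"
    by (simp add: poly_sum e_def poly_prod w_def algebra_simps)
  then have "F1 \<rho> n z
      = (\<Sum>k\<le>n. (b_coeff \<rho> n k + a_coeff \<rho> n k * w k) * (\<Prod>j\<in>{..n} - {k}. (w j)\<^sup>2)
          / (\<Prod>j\<le>n. (w j)\<^sup>2))"
    unfolding F1_eq_poly w_def[symmetric] by (simp add: sum_divide_distrib)
  also have "\<dots> = (\<Sum>k\<le>n. b_coeff \<rho> n k / (w k)\<^sup>2 + a_coeff \<rho> n k / w k)"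
  proof (intro sum.cong refl)
    fix k assume "k \<in> {..n}"
    then have "(\<Prod>j\<le>n. (w j)\<^sup>2) = (w k)\<^sup>2 * (\<Prod>j\<in>{..n} - {k}. (w j)\<^sup>2)"
      by (simp add: prod.remove)
    moreover have "(\<Prod>j\<in>{..n} - {k}. (w j)\<^sup>2) \<noteq> 0"
      using w by simp
    ultimately show "(b_coeff \<rho> n k + a_coeff \<rho> n k * w k) * (\<Prod>j\<in>{..n} - {k}. (w j)\<^sup>2)
        / (\<Prod>j\<le>n. (w j)\<^sup>2) = b_coeff \<rho> n k / (w k)\<^sup>2 + a_coeff \<rho> n k / w k"
      using w[of k] by (simp add: add_divide_distrib power2_eq_square)
  qed
  finally show ?thesis unfolding w_def .
qed

lemma F1_has_real_derivative:
  assumes n: "n \<ge> 1" and z: "z > - 1"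
  shows "(F1 \<rho> n has_real_derivative
    - (\<Sum>k\<le>n. 2 * b_coeff \<rho> n k / (z + real k + 1)^3 + a_coeff \<rho> n k / (z + real k + 1)^2)) (at z)"
proof -
  have "((\<lambda>z. \<Sum>k\<le>n. b_coeff \<rho> n k / (z + real k + 1)\<^sup>2 + a_coeff \<rho> n k / (z + real k + 1))
    has_real_derivative
    (\<Sum>k\<le>n. - (2 * b_coeff \<rho> n k / (z + real k + 1)^3 + a_coeff \<rho> n k / (z + real k + 1)^2))) (at z)"
  proof (intro DERIV_sum)
    fix k
    define w where "w = z + real k + 1"
    have "w \<noteq> 0" using z by (simp add: w_def)
    then show "((\<lambda>z. b_coeff \<rho> n k / (z + real k + 1)\<^sup>2 + a_coeff \<rho> n k / (z + real k + 1))
      has_real_derivative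
      - (2 * b_coeff \<rho> n k / (z + real k + 1)^3 + a_coeff \<rho> n k / (z + real k + 1)^2)) (at z)"
      by (auto intro!: derivative_eq_intros simp: w_def[symmetric])
        (simp add: divide_simps, algebra)
  qed
  \<comment> \<open>The expansion holds on the open half-line to the right of -1, which contains
    \<open>z\<close>, so the derivative carries over.\<close>
  then show ?thesis
    unfolding sum_negf
    by (rule has_field_derivative_transform_within_open[of _ _ _ "{- 1<..}"])
      (use z F1_partial_fractions[OF n] in auto)
qed

section \<open>Zeta values and the linear form in zeta(3)\<close>

definition zeta_sum :: "nat \<Rightarrow> real" where
  "zeta_sum r = (\<Sum>j. 1 / (real j + 1) ^ r)"

text \<open>For these \<open>r\<close>, \<open>zeta_sum r\<close> is zeta(r), and the shifted series
  is its tail after \<open>k\<close> terms.\<close>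

lemma sums_inverse_power_shift:
  assumes "r \<ge> 2"
  shows "(\<lambda>j. 1 / (real j + real k + 1) ^ r) sums (zeta_sum r - gen_harm r k)"
proof -
  have "summable (\<lambda>j. inverse (real (j + 1) ^ r))"
    by (subst summable_iff_shift) (rule inverse_power_summable[OF assms])
  then have s: "summable (\<lambda>j. 1 / (real j + 1) ^ r)"
    by (simp add: divide_inverse add.commute)
  have "gen_harm r k = (\<Sum>j<k. 1 / (real j + 1) ^ r)"
    unfolding gen_harm_def by (induction k) (auto simp: add.commute)
  then show ?thesis
    using sums_split_initial_segment[OF summable_sums[OF s], of k] by (simp add: zeta_sum_def)
qed

text \<open>Differentiation raises the pole orders to 3 and 2, so each partial fraction is summable
  on its own. The multiples of \<open>zeta_sum 2\<close> cancel by \<open>sum_a_coeff\<close>, and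
  the harmonic parts assemble into \<open>p_seq\<close>.\<close>

lemma F2_sums:
  assumes n: "n \<ge> 1"
  shows "(\<lambda>j. F2 \<rho> n (real j)) sums (- 2 * (q_seq \<rho> n * zeta_sum 3 - p_seq \<rho> n))"
proof -
  have "F2 \<rho> n (real j) = - (\<Sum>k\<le>n. 2 * b_coeff \<rho> n k * (1 / (real j + real k + 1)^3)
      + a_coeff \<rho> n k * (1 / (real j + real k + 1)^2))" for j
    unfolding F2_def using DERIV_imp_deriv[OF F1_has_real_derivative[OF n, of "real j" \<rho>]] by simp
  moreover have "(\<lambda>j. - (\<Sum>k\<le>n. 2 * b_coeff \<rho> n k * (1 / (real j + real k + 1)^3)
      + a_coeff \<rho> n k * (1 / (real j + real k + 1)^2))) sums
    - (\<Sum>k\<le>n. 2 * b_coeff \<rho> n k * (zeta_sum 3 - gen_harm 3 k)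
      + a_coeff \<rho> n k * (zeta_sum 2 - gen_harm 2 k))"
    by (intro sums_minus sums_sum sums_add sums_mult sums_inverse_power_shift) auto
  moreover have "(\<Sum>k\<le>n. 2 * b_coeff \<rho> n k * (zeta_sum 3 - gen_harm 3 k)
      + a_coeff \<rho> n k * (zeta_sum 2 - gen_harm 2 k))
    = 2 * (q_seq \<rho> n * zeta_sum 3 - p_seq \<rho> n)"
  proof -
    \<comment> \<open>The added term \<open>k = 0\<close> vanishes because
      \<open>gen_harm r 0 = 0\<close>.\<close>
    have p: "p_seq \<rho> n = (\<Sum>k\<le>n. b_coeff \<rho> n k * gen_harm 3 k + 1 / 2 * a_coeff \<rho> n k * gen_harm 2 k)"
      unfolding p_seq_def by (intro sum.mono_neutral_left) (auto simp: gen_harm_def)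
    have q: "q_seq \<rho> n = (\<Sum>k\<le>n. b_coeff \<rho> n k)"
      by (simp add: q_seq_def atMost_atLeast0)
    have "(\<Sum>k\<le>n. 2 * b_coeff \<rho> n k * (zeta_sum 3 - gen_harm 3 k)
        + a_coeff \<rho> n k * (zeta_sum 2 - gen_harm 2 k))
      = (\<Sum>k\<le>n. 2 * (b_coeff \<rho> n k * zeta_sum 3)
          - 2 * (b_coeff \<rho> n k * gen_harm 3 k + 1 / 2 * a_coeff \<rho> n k * gen_harm 2 k)
          + a_coeff \<rho> n k * zeta_sum 2)"
      by (intro sum.cong) (auto simp: algebra_simps)
    also have "\<dots> = 2 * (q_seq \<rho> n * zeta_sum 3) - 2 * p_seq \<rho> n
        + (\<Sum>k\<le>n. a_coeff \<rho> n k) * zeta_sum 2"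
      unfolding p q
      by (simp only: sum.distrib sum_subtractf sum_distrib_left[symmetric] sum_distrib_right[symmetric])
    finally show ?thesis using sum_a_coeff[OF n] by simp
  qed
  ultimately show ?thesis by simp
qed

lemma r_seq_eq:
  assumes "n \<ge> 1"
  shows "r_seq \<rho> n = q_seq \<rho> n * zeta_sum 3 - p_seq \<rho> n"
  unfolding r_seq_def using sums_unique[OF F2_sums[OF assms, of \<rho>]] by simp

section \<open>The recurrence for the remainders\<close>

definition telescoper :: "nat \<Rightarrow> nat \<Rightarrow> real \<Rightarrow> real" where
  "telescoper \<rho> n z = (pochhammer (- z) n)\<^sup>2 * shifted_cert (real \<rho>) (real n) z / (pochhammer (z + 1) (n + 2))\<^sup>2"

text \<open>Taking out the common factor \<open>t\<close> reduces the claim to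
  \<open>shifted_cert_identity\<close>; \<open>z > - 1\<close> keeps the denominators
  nonzero.\<close>

lemma F1_telescoping:
  assumes n: "n \<ge> 1" and z: "z > - 1"
  shows "(real n + 1)\<^sup>2 * ((real n + 2) ^ 4 * Phi (real \<rho>) (real n) * F1 \<rho> (n + 2) z
      + beta (real \<rho>) (real n) * F1 \<rho> (n + 1) z
      + real n ^ 4 * Phi (real \<rho>) (real n + 1) * F1 \<rho> n z) = telescoper \<rho> n (z + 1) - telescoper \<rho> n z"
proof -
  define A B where "A = pochhammer (- z) (n - 1)" and "B = pochhammer (z + 1) (n + 1)"
  define d1 d2 where "d1 = z + real n + 2" and "d2 = z + real n + 3"
  define t where "t = A\<^sup>2 / (B\<^sup>2 * d1\<^sup>2 * d2\<^sup>2)"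
  define X where "X = shifted_cert (real \<rho>) (real n)"
  define c2 c1 c0 where "c2 = (real n + 2) ^ 4 * Phi (real \<rho>) (real n)"
    and "c1 = beta (real \<rho>) (real n)" and "c0 = real n ^ 4 * Phi (real \<rho>) (real n + 1)"
  have d: "d1 \<noteq> 0" "d2 \<noteq> 0" using z by (auto simp: d1_def d2_def)
  have B: "B \<noteq> 0" using z unfolding B_def by (intro pochhammer_pos[THEN less_imp_neq, symmetric]) simp
  obtain m where m: "n = Suc m" using n by (cases n) auto
  have A1: "pochhammer (- z) n = A * (real n - 1 - z)"
    by (simp add: A_def m pochhammer_Suc)
  have A2: "pochhammer (- z) (n + 1) = A * (real n - 1 - z) * (real n - z)"
    using A1 by (simp add: pochhammer_Suc)
  \<comment> \<open>Squared, this gives \<open>(z + 1)^2\<close>, and \<open>B3\<close> gives it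
    once more: the source of \<open>(z + 1)^4\<close> in the certificate identity.\<close>
  have A3: "pochhammer (- (z + 1)) n = - (z + 1) * A"
    by (simp add: A_def m pochhammer_rec)
  have B1: "pochhammer (z + 1) (n + 2) = B * d1"
    by (simp add: B_def d1_def pochhammer_Suc algebra_simps)
  have B2: "pochhammer (z + 1) (n + 3) = B * d1 * d2"
    by (simp add: B_def d1_def d2_def pochhammer_Suc numeral_3_eq_3 algebra_simps)
  have B3: "pochhammer (z + 1 + 1) (n + 2) = B * d1 * d2 / (z + 1)"
    using B2 pochhammer_rec[of "z + 1" "n + 2"] z by (simp add: field_simps numeral_3_eq_3)
  have F_2: "F1 \<rho> (n + 2) z
      = t * ((real n - 1 - z)^2 * (real n - z)^2 * (z - real n - 1) * (z - \<rho> * (real n+2)))"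
  proof -
    have "F1 \<rho> (n + 2) z = (A * (real n - 1 - z) * (real n - z))\<^sup>2 * (z - real n - 1)
        * (z - \<rho> * (real n + 2)) / (B * d1 * d2)\<^sup>2"
    proof -
      have "n + 2 - 1 = n + 1" "n + 2 + 1 = n + 3"
        "z - real (n + 2) + 1 = z - real n - 1" "real (n + 2) = real n + 2" by simp_all
      then show ?thesis by (simp only: F1_def A2 B2)
    qed
    then show ?thesis by (simp add: t_def power_mult_distrib mult.assoc)
  qed
  have F_1: "F1 \<rho> (n + 1) z
      = t * ((real n - 1 - z)^2 * d2^2 * (z - real n) * (z - \<rho> * (real n+1)))"
  proof -
    have "F1 \<rho> (n + 1) z = (A * (real n - 1 - z))\<^sup>2 * (z - real n)
        * (z - \<rho> * (real n + 1)) / (B * d1)\<^sup>2"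
    proof -
      have "n + 1 - 1 = n" "n + 1 + 1 = n + 2"
        "z - real (n + 1) + 1 = z - real n" "real (n + 1) = real n + 1" by simp_all
      then show ?thesis by (simp only: F1_def A1 B1)
    qed
    then show ?thesis using d by (simp add: t_def power_mult_distrib mult.assoc)
  qed
  have F_0: "F1 \<rho> n z = t * (d1^2 * d2^2 * (z - real n + 1) * (z - \<rho> * real n))"
    using d by (simp add: F1_def t_def A_def B_def power_mult_distrib mult.assoc)
  have G1: "telescoper \<rho> n (z + 1) = t * ((z + 1)^4 * X (z + 1))"
    unfolding telescoper_def A3 B3 X_def[symmetric] using z B d
    by (simp add: t_def divide_simps) algebra
  have G0: "telescoper \<rho> n z = t * ((real n - 1 - z)^2 * d2^2 * X z)"
    unfolding telescoper_def A1 B1 X_def[symmetric] using B d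
    by (simp add: t_def power_mult_distrib)
  have "(real n + 1)\<^sup>2 * (c2 * F1 \<rho> (n + 2) z + c1 * F1 \<rho> (n + 1) z + c0 * F1 \<rho> n z)
      = t * ((real n + 1)\<^sup>2 *
          (c2 * ((real n - 1 - z)^2 * (real n - z)^2 * (z - real n - 1) * (z - \<rho> * (real n+2)))
         + c1 * ((real n - 1 - z)^2 * d2^2 * (z - real n) * (z - \<rho> * (real n+1)))
         + c0 * (d1^2 * d2^2 * (z - real n + 1) * (z - \<rho> * real n))))"
    unfolding F_0 F_1 F_2 by algebra
  also have "\<dots> = t * ((z + 1)^4 * X (z + 1) - (real n - 1 - z)^2 * d2^2 * X z)"
    unfolding c2_def c1_def c0_def X_def d1_def d2_def shifted_cert_identity by simp
  also have "\<dots> = telescoper \<rho> n (z + 1) - telescoper \<rho> n z"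
    unfolding G0 G1 by algebra
  finally show ?thesis unfolding c2_def c1_def c0_def .
qed

text \<open>In the quotient rule the numerator has degree at most \<open>2 * degree q - 1\<close>,
  below the degree of the squared denominator.\<close>

lemma deriv_rational_tendsto_0:
  fixes p q :: "real poly"
  assumes deg: "degree p \<le> degree q" and q: "degree q > 0"
  shows "((\<lambda>x. (poly (pderiv p) x * poly q x - poly p x * poly (pderiv q) x) / (poly q x)\<^sup>2)
    \<longlongrightarrow> 0) at_infinity"
proof -
  have "degree (pderiv p * q - p * pderiv q) < degree (q\<^sup>2)"
  proof -
    have "degree (pderiv p * q) \<le> degree q - 1 + degree q"
      using degree_mult_le[of "pderiv p" q] deg by (simp add: degree_pderiv)
    moreover have "degree (p * pderiv q) \<le> degree q - 1 + degree q"
      using degree_mult_le[of p "pderiv q"] deg by (simp add: degree_pderiv)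
    ultimately have "degree (pderiv p * q - p * pderiv q) \<le> degree q - 1 + degree q"
      by (rule degree_diff_le)
    moreover have "degree (q\<^sup>2) = 2 * degree q"
      using q by (subst degree_power_eq) auto
    ultimately show ?thesis using q by linarith
  qed
  from poly_divide_tendsto_0_at_infinity[OF this] show ?thesis by simp
qed

text \<open>This supplies both ends of the telescoping sum of derivatives: the value at 0 and the
  limit along the integers.\<close>

lemma telescoper_has_real_derivative:
  assumes n: "n \<ge> 1"
  shows "\<exists>telescoper'. (\<forall>z>- 1. (telescoper \<rho> n has_real_derivative telescoper' z) (at z)) \<and> telescoper' 0 = 0
    \<and> (\<lambda>j. telescoper' (real j)) \<longlonglongrightarrow> 0"
proof -
  define c where "c = [:cert0 (real \<rho>) (real n), cert1 (real \<rho>) (real n),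
    cert2 (real \<rho>) (real n), cert3 (real \<rho>) (real n):]"
  define p0 where "p0 = (\<Prod>i<n. [:real i, - 1:])"
  define p where "p = p0\<^sup>2 * ([:- real n, 1:] * c)"
  define q where "q = (\<Prod>i<n + 2. [:real i + 1, 1:]\<^sup>2)"
  define telescoper' where "telescoper' z = (poly (pderiv p) z * poly q z - poly p z * poly (pderiv q) z) / (poly q z)\<^sup>2" for z
  have p0: "poly p0 z = pochhammer (- z) n" for z
    by (simp add: p0_def poly_prod pochhammer_prod atLeast0LessThan algebra_simps)
  have q_eq: "poly q z = (pochhammer (z + 1) (n + 2))\<^sup>2" for z
    unfolding q_def pochhammer_square_eq_prod poly_prod
    by (intro prod.cong) (auto simp: algebra_simps)
  have "poly c z = cert (real \<rho>) (real n) z" for z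
    by (simp add: c_def cert_def algebra_simps power2_eq_square power3_eq_cube)
  then have G_eq: "telescoper \<rho> n = (\<lambda>z. poly p z / poly q z)"
    by (auto simp: telescoper_def p_def p0 q_eq shifted_cert_def algebra_simps fun_eq_iff)
  have "poly q z > 0" if "z > - 1" for z
    unfolding q_eq using pochhammer_pos[of "z + 1" "n + 2"] that by simp
  then have "(telescoper \<rho> n has_real_derivative telescoper' z) (at z)" if "z > - 1" for z
    unfolding G_eq telescoper'_def using that
    by (auto intro!: derivative_eq_intros simp: power2_eq_square less_imp_neq[symmetric])
  moreover have "telescoper' 0 = 0"
  proof -
    \<comment> \<open>As \<open>p\<close> contains the square of \<open>p0\<close>, both
      \<open>p\<close> and its derivative vanish at 0.\<close>
    have "poly p0 0 = 0" using n by (simp add: p0 pochhammer_0_left)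
    then show ?thesis
      by (simp add: telescoper'_def p_def pderiv_mult power2_eq_square)
  qed
  moreover have "(\<lambda>j. telescoper' (real j)) \<longlonglongrightarrow> 0"
  proof -
    \<comment> \<open>The factor \<open>z - n\<close> and the cubic \<open>c\<close> add 4 to
      \<open>2 * n\<close>, which matches the degree of \<open>q\<close>; hence the telescoper is
      bounded at infinity.\<close>
    have "degree c \<le> 3" by (simp add: c_def)
    moreover have "degree (p0\<^sup>2) \<le> 2 * n"
      using degree_prod_sum_le[of "{..<n}" "\<lambda>i. [:real i, - 1:]"] 
      by (intro order.trans[OF degree_power_le]) (simp add: p0_def)
    moreover have "degree ([:- real n, 1:] * c) \<le> 1 + degree c"
      by (rule order.trans[OF degree_mult_le]) simp
    ultimately have "degree p \<le> 2 * n + 4"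
      unfolding p_def by (intro order.trans[OF degree_mult_le]) linarith
    moreover have "degree q = 2 * n + 4"
      unfolding q_def by (subst degree_prod_eq_sum_degree) (auto simp: degree_power_eq)
    ultimately have "(telescoper' \<longlongrightarrow> 0) at_infinity"
      unfolding telescoper'_def by (intro deriv_rational_tendsto_0) auto
    then have "(telescoper' \<longlongrightarrow> 0) at_top"
      by (rule tendsto_mono[OF at_top_le_at_infinity])
    then show ?thesis
      by (rule filterlim_compose[OF _ filterlim_real_sequentially])
  qed
  ultimately show ?thesis by blast
qed

lemma r_recurrence:
  assumes n: "n \<ge> 1"
  shows "(real n + 2) ^ 4 * Phi (real \<rho>) (real n) * r_seq \<rho> (n + 2)
           + beta (real \<rho>) (real n) * r_seq \<rho> (n + 1)
           + real n ^ 4 * Phi (real \<rho>) (real n + 1) * r_seq \<rho> n = 0"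
proof -
  define c2 c1 c0 where "c2 = (real n + 2) ^ 4 * Phi (real \<rho>) (real n)"
    and "c1 = beta (real \<rho>) (real n)" and "c0 = real n ^ 4 * Phi (real \<rho>) (real n + 1)"
  obtain telescoper' where telescoper': "\<And>z. z > - 1 \<Longrightarrow> (telescoper \<rho> n has_real_derivative telescoper' z) (at z)"
    and telescoper'0: "telescoper' 0 = 0" and telescoper'_lim: "(\<lambda>j. telescoper' (real j)) \<longlonglongrightarrow> 0"
    using telescoper_has_real_derivative[OF n, of \<rho>] by blast
  have F2: "(F1 \<rho> m has_real_derivative F2 \<rho> m z) (at z)" if "m \<ge> 1" "z > - 1" for m z
    unfolding F2_def DERIV_imp_deriv[OF F1_has_real_derivative[OF that]]
    by (rule F1_has_real_derivative[OF that])
  \<comment> \<open>\<open>L\<close> is linear with coefficients free of \<open>z\<close>, so it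
    commutes with differentiation in \<open>z\<close> and with summation over
    \<open>j\<close>.\<close>
  define L where "L m0 m1 m2 = (real n + 1)\<^sup>2 * (c2 * m2 + c1 * m1 + c0 * m0)" for m0 m1 m2 :: real
  have L: "L (F2 \<rho> n (real j)) (F2 \<rho> (n + 1) (real j)) (F2 \<rho> (n + 2) (real j))
      = telescoper' (real (Suc j)) - telescoper' (real j)" for j
  proof -
    define z where "z = real j"
    have z: "z > - 1" by (simp add: z_def)
    have "((\<lambda>z. L (F1 \<rho> n z) (F1 \<rho> (n + 1) z) (F1 \<rho> (n + 2) z)) has_real_derivative
        L (F2 \<rho> n z) (F2 \<rho> (n + 1) z) (F2 \<rho> (n + 2) z)) (at z)"
      unfolding L_def using n z by (intro DERIV_cmult DERIV_add F2) auto
    moreover have "((\<lambda>z. L (F1 \<rho> n z) (F1 \<rho> (n + 1) z) (F1 \<rho> (n + 2) z)) has_real_derivative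
        telescoper' (z + 1) - telescoper' z) (at z)"
    proof (rule has_field_derivative_transform_within_open[of "\<lambda>z. telescoper \<rho> n (z + 1) - telescoper \<rho> n z" _ _ "{- 1<..}"])
      have "((\<lambda>z. telescoper \<rho> n (z + 1)) has_real_derivative telescoper' (z + 1)) (at z)"
        using telescoper'[of "z + 1"] z by (simp add: DERIV_shift)
      then show "((\<lambda>z. telescoper \<rho> n (z + 1) - telescoper \<rho> n z) has_real_derivative telescoper' (z + 1) - telescoper' z) (at z)"
        using telescoper'[OF z] by (rule DERIV_diff)
    qed (use z F1_telescoping[OF n] in \<open>auto simp: L_def c2_def c1_def c0_def\<close>)
    ultimately have "L (F2 \<rho> n z) (F2 \<rho> (n + 1) z) (F2 \<rho> (n + 2) z) = telescoper' (z + 1) - telescoper' z"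
      by (rule DERIV_unique)
    then show ?thesis by (simp add: z_def add.commute)
  qed
  have r: "(\<lambda>j. F2 \<rho> m (real j)) sums (- 2 * r_seq \<rho> m)" if "m \<ge> 1" for m
    using F2_sums[OF that, of \<rho>] r_seq_eq[OF that, of \<rho>] by simp
  have "(\<lambda>j. L (F2 \<rho> n (real j)) (F2 \<rho> (n + 1) (real j)) (F2 \<rho> (n + 2) (real j))) sums
      L (- 2 * r_seq \<rho> n) (- 2 * r_seq \<rho> (n + 1)) (- 2 * r_seq \<rho> (n + 2))"
    unfolding L_def using n by (intro sums_mult sums_add r) auto
  moreover have "(\<lambda>j. L (F2 \<rho> n (real j)) (F2 \<rho> (n + 1) (real j)) (F2 \<rho> (n + 2) (real j))) sums (0 - telescoper' (real 0))"
    unfolding L by (rule telescope_sums[OF telescoper'_lim])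
  ultimately have "L (- 2 * r_seq \<rho> n) (- 2 * r_seq \<rho> (n + 1)) (- 2 * r_seq \<rho> (n + 2)) = 0"
    using sums_unique2 telescoper'0 by fastforce
  then have "(real n + 1)\<^sup>2 * (- 2) * (c2 * r_seq \<rho> (n + 2) + c1 * r_seq \<rho> (n + 1) + c0 * r_seq \<rho> n) = 0"
    unfolding L_def by (simp only: algebra_simps)
  then show ?thesis
    unfolding c2_def c1_def c0_def by (simp add: add_nonneg_eq_0_iff)
qed

section \<open>The recurrence for all three sequences\<close>

theorem theorem2:
  fixes \<rho> n :: nat and y :: "nat \<Rightarrow> real"
  assumes "\<rho> \<ge> 1" and "n \<ge> 1"
    and "y \<in> {q_seq \<rho>, p_seq \<rho>, r_seq \<rho>}"
  shows "(real n + 2) ^ 4 * Phi (real \<rho>) (real n) * y (n + 2)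
           + beta (real \<rho>) (real n) * y (n + 1)
           + real n ^ 4 * Phi (real \<rho>) (real n + 1) * y n = 0"
proof -
  note q = q_recurrence[OF assms(2), of \<rho>] and r = r_recurrence[OF assms(2), of \<rho>]
  \<comment> \<open>\<open>zeta_sum 3\<close> does not depend on \<open>m\<close>, so the
    recurrences of \<open>q_seq\<close> and \<open>r_seq\<close> pass to this combination.\<close>
  have p: "p_seq \<rho> m = q_seq \<rho> m * zeta_sum 3 - r_seq \<rho> m" if "m \<ge> 1" for m
    using r_seq_eq[OF that, of \<rho>] by simp
  have "(real n + 2) ^ 4 * Phi (real \<rho>) (real n) * p_seq \<rho> (n + 2)
           + beta (real \<rho>) (real n) * p_seq \<rho> (n + 1)
           + real n ^ 4 * Phi (real \<rho>) (real n + 1) * p_seq \<rho> n = 0"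
    using q r p[of n] p[of "n + 1"] p[of "n + 2"] assms(2) by simp algebra
  then show ?thesis using assms(3) q r by blast
qed

end
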